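(* For $\sigma\in\mathbb{C}$ not an eigenvalue of $\mathcal{H}$ and $\phi_1\in X$ a real-valued function, let $\lambda\neq0$ be a simple eigenvalue of $\mathcal{H}$ (or equivalently of the nonlinear eigenvalue problem $M(\lambda)v=0$) with associated eigenfunction $\varphi_{+}$, and let $\varphi_{-}$ be the eigenfunction of $\mathcal{H}$ associated with the eigenvalue $-\lambda$. Then the dimension of the intersection of $\mathrm{span}\{\varphi_{+},\varphi_{-}\}$ and $\mathrm{K}_m(\mathcal{R}_{\sigma}^{-1},\phi_1)$ is at most $1$.
   Context: Let $n,K$ be positive integers, $0<\tau_1<\dots<\tau_K<\infty$, and let $H_0,H_1,H_{-1},\dots,H_K,H_{-K}\in\mathbb{R}^{2n\times 2n}$. Let $J=\begin{bmatrix}0&I_n\\-I_n&0\end{bmatrix}$. Standing assumption: $(JH_0)^{\top}=JH_0$ and $(JH_{-k})^{\top}=JH_k$ for $k=1,\dots,K$. The characteristic matrix is $M(\lambda)=\lambda I_{2n}-H_0-\sum_{k=1}^K(H_{-k}e^{-\lambda\tau_k}+H_ke^{\lambda\tau_k})$. Let $X=C([-\tau_K,\tau_K],\mathbb{C}^{2n})$. The operator $\mathcal{H}:D(\mathcal{H})\subseteq X\to X$ is $\mathcal{H}\varphi=\varphi'$ with $$D(\mathcal{H})=\Big\{\varphi\in X:\varphi'\in X,\ \varphi'(0)=H_0\varphi(0)+\sum_{k=1}^K\big(H_{-k}\varphi(-\tau_k)+H_k\varphi(\tau_k)\big)\Big\}.$$ An eigenvalue is simple if it has algebraic multiplicity one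 (for the nonlinear eigenvalue problem: it is a simple zero of $\det M$). For $\sigma\in\mathbb{C}$, let $\mathcal{R}_{\sigma}=(\mathcal{H}-\sigma\mathcal{I}_X)(\mathcal{H}+\sigma\mathcal{I}_X)$, i.e. $\mathcal{R}_{\sigma}\varphi=\varphi''-\sigma^2\varphi$ with domain $D(\mathcal{R}_{\sigma})$ consisting of all $\varphi\in X$ with $\varphi',\varphi''\in X$ satisfying $$\varphi'(0)=H_0\varphi(0)+\sum_{k=1}^K\big(H_{-k}\varphi(-\tau_k)+H_k\varphi(\tau_k)\big),\qquad \varphi''(0)=H_0\varphi'(0)+\sum_{k=1}^K\big(H_{-k}\varphi'(-\tau_k)+H_k\varphi'(\tau_k)\big).$$ If $\sigma$ is not an eigenvalue of $\mathcal{H}$, then $\mathcal{R}_{\sigma}:D(\mathcal{R}_\sigma)\to X$ is invertible, with inverse $\mathcal{R}_{\sigma}^{-1}:X\to D(\mathcal{R}_{\sigma})\subseteq X$. For a positive integer $m$, the Krylov subspace is $$\mathrm{K}_m(\mathcal{R}_{\sigma}^{-1},\phi_1)=\mathrm{span}\{\phi_1,\mathcal{R}_{\sigma}^{-1}\phi_1,\mathcal{R}_{\sigma}^{-2}\phi_1,\dots,\mathcal{R}_{\sigma}^{-(m-1)}\phi_1\}\subseteq X.$$ *)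

theory Defs
  imports "HOL-Complex_Analysis.Complex_Analysis" "HOL-Library.Function_Algebras"
begin

text \<open>
  The index type \<open>'n + 'n\<close> has \<open>2 * CARD('n)\<close> elements, so that
  \<open>complex ^ ('n + 'n)\<close> is the space of complex vectors of length \<open>2n\<close> with its splitting into
  two blocks.
\<close>

definition Jmat :: "real ^ ('n::finite + 'n) ^ ('n + 'n)" where
  "Jmat = (\<chi> i j. case (i, j) of
      (Inl a, Inr b) \<Rightarrow> if a = b then 1 else 0
    | (Inr a, Inl b) \<Rightarrow> if a = b then - 1 else 0
    | _ \<Rightarrow> 0)"

abbreviation cmat :: "real ^ 'm ^ 'k \<Rightarrow> complex ^ 'm ^ 'k" where
  "cmat \<equiv> map_matrix complex_of_real"


text \<open>
  The matrices \<open>H\<^sub>k\<close>, for \<open>k\<close> between \<open>-K\<close> and \<open>K\<close>, are given by a function on the integers, and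
  the delays \<open>\<tau>\<^sub>k\<close>, for \<open>k\<close> between \<open>1\<close> and \<open>K\<close>, by a function on the naturals; values outside
  these ranges are never used.
\<close>

definition char_matrix ::
  "nat \<Rightarrow> (nat \<Rightarrow> real) \<Rightarrow> (int \<Rightarrow> real ^ 'm ^ 'm) \<Rightarrow> complex \<Rightarrow> complex ^ 'm::finite ^ 'm" where
  "char_matrix K \<tau> H z = (\<chi> i j. (mat z :: complex ^ 'm ^ 'm) $ i $ j - of_real (H 0 $ i $ j)
     - (\<Sum>k=1..K. of_real (H (- int k) $ i $ j) * exp (- z * of_real (\<tau> k))
                 + of_real (H (int k) $ i $ j) * exp (z * of_real (\<tau> k))))"

definition simple_nlevp_eigenvalue ::
  "nat \<Rightarrow> (nat \<Rightarrow> real) \<Rightarrow> (int \<Rightarrow> real ^ 'm::finite ^ 'm) \<Rightarrow> complex \<Rightarrow> bool" where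
  "simple_nlevp_eigenvalue K \<tau> H z \<longleftrightarrow>
     (\<exists>v. v \<noteq> 0 \<and> char_matrix K \<tau> H z *v v = 0) \<and>
     zorder (\<lambda>w. det (char_matrix K \<tau> H w)) z = 1"


section \<open>The function space\<close>

text \<open>
  An element of \<open>C([-r, r])\<close> is represented by the function on the whole line that extends it by
  zero. This representation is unique, so equality and linear independence are those of
  \<open>C([-r, r])\<close>. Derivatives are taken within \<open>[-r, r]\<close>, hence are one-sided at the end points.
\<close>

definition cfun_space :: "real \<Rightarrow> (real \<Rightarrow> complex ^ 'm::finite) set" where
  "cfun_space r = {f. continuous_on {-r..r} f \<and> (\<forall>t. t \<notin> {-r..r} \<longrightarrow> f t = 0)}"

definition dfun :: "real \<Rightarrow> (real \<Rightarrow> complex ^ 'm::finite) \<Rightarrow> real \<Rightarrow> complex ^ 'm" where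
  "dfun r f = (\<lambda>t. if t \<in> {-r..r} then vector_derivative f (at t within {-r..r}) else 0)"

definition c1fun_space :: "real \<Rightarrow> (real \<Rightarrow> complex ^ 'm::finite) set" where
  "c1fun_space r = {f \<in> cfun_space r. f differentiable_on {-r..r} \<and> dfun r f \<in> cfun_space r}"

definition cscale :: "complex \<Rightarrow> (real \<Rightarrow> complex ^ 'm::finite) \<Rightarrow> real \<Rightarrow> complex ^ 'm" where
  "cscale c f = (\<lambda>t. c *s f t)"

global_interpretation cfun:
  vector_space "cscale :: complex \<Rightarrow> (real \<Rightarrow> complex ^ 'm::finite) \<Rightarrow> real \<Rightarrow> complex ^ 'm"
  by unfold_locales (auto simp: cscale_def fun_eq_iff vec_eq_iff algebra_simps)


section \<open>The operators\<close>

definition coupling ::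
  "nat \<Rightarrow> (nat \<Rightarrow> real) \<Rightarrow> (int \<Rightarrow> real ^ 'm ^ 'm) \<Rightarrow> (real \<Rightarrow> complex ^ 'm::finite) \<Rightarrow> complex ^ 'm" where
  "coupling K \<tau> H f = cmat (H 0) *v f 0
     + (\<Sum>k=1..K. cmat (H (- int k)) *v f (- \<tau> k) + cmat (H (int k)) *v f (\<tau> k))"

definition Hop_dom ::
  "nat \<Rightarrow> (nat \<Rightarrow> real) \<Rightarrow> (int \<Rightarrow> real ^ 'm ^ 'm) \<Rightarrow> (real \<Rightarrow> complex ^ 'm::finite) set" where
  "Hop_dom K \<tau> H = {f \<in> c1fun_space (\<tau> K). dfun (\<tau> K) f 0 = coupling K \<tau> H f}"

definition Hop ::
  "nat \<Rightarrow> (nat \<Rightarrow> real) \<Rightarrow> (real \<Rightarrow> complex ^ 'm::finite) \<Rightarrow> real \<Rightarrow> complex ^ 'm" where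
  "Hop K \<tau> f = dfun (\<tau> K) f"

definition Hop_eigenfunction ::
  "nat \<Rightarrow> (nat \<Rightarrow> real) \<Rightarrow> (int \<Rightarrow> real ^ 'm ^ 'm) \<Rightarrow> complex
     \<Rightarrow> (real \<Rightarrow> complex ^ 'm::finite) \<Rightarrow> bool" where
  "Hop_eigenfunction K \<tau> H z f \<longleftrightarrow> f \<in> Hop_dom K \<tau> H \<and> f \<noteq> 0 \<and> Hop K \<tau> f = cscale z f"

definition Hop_eigenvalue ::
  "nat \<Rightarrow> (nat \<Rightarrow> real) \<Rightarrow> (int \<Rightarrow> real ^ 'm::finite ^ 'm) \<Rightarrow> complex \<Rightarrow> bool" where
  "Hop_eigenvalue K \<tau> H z \<longleftrightarrow> (\<exists>f. Hop_eigenfunction K \<tau> H z f)"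

text \<open>The kernel of the \<open>j\<close>-th power of \<open>\<H> - z\<close> on the natural domain of that power.\<close>

primrec Hop_kernel ::
  "nat \<Rightarrow> (nat \<Rightarrow> real) \<Rightarrow> (int \<Rightarrow> real ^ 'm ^ 'm) \<Rightarrow> complex \<Rightarrow> nat
     \<Rightarrow> (real \<Rightarrow> complex ^ 'm::finite) set" where
  "Hop_kernel K \<tau> H z 0 = {0}"
| "Hop_kernel K \<tau> H z (Suc j) =
     {f \<in> Hop_dom K \<tau> H. Hop K \<tau> f - cscale z f \<in> Hop_kernel K \<tau> H z j}"

text \<open>
  The algebraic multiplicity is the dimension of the generalized eigenspace. The library's
  dimension is \<open>0\<close> for infinite-dimensional spaces, which does not affect the condition \<open>= 1\<close>.
\<close>

definition simple_Hop_eigenvalue ::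
  "nat \<Rightarrow> (nat \<Rightarrow> real) \<Rightarrow> (int \<Rightarrow> real ^ 'm::finite ^ 'm) \<Rightarrow> complex \<Rightarrow> bool" where
  "simple_Hop_eigenvalue K \<tau> H z \<longleftrightarrow>
     Hop_eigenvalue K \<tau> H z \<and> cfun.dim (\<Union>j. Hop_kernel K \<tau> H z j) = 1"

definition Rop_dom ::
  "nat \<Rightarrow> (nat \<Rightarrow> real) \<Rightarrow> (int \<Rightarrow> real ^ 'm ^ 'm) \<Rightarrow> (real \<Rightarrow> complex ^ 'm::finite) set" where
  "Rop_dom K \<tau> H = {f \<in> c1fun_space (\<tau> K). dfun (\<tau> K) f \<in> c1fun_space (\<tau> K)
     \<and> dfun (\<tau> K) f 0 = coupling K \<tau> H f
     \<and> dfun (\<tau> K) (dfun (\<tau> K) f) 0 = coupling K \<tau> H (dfun (\<tau> K) f)}"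

definition Rop ::
  "nat \<Rightarrow> (nat \<Rightarrow> real) \<Rightarrow> complex \<Rightarrow> (real \<Rightarrow> complex ^ 'm::finite) \<Rightarrow> real \<Rightarrow> complex ^ 'm" where
  "Rop K \<tau> \<sigma> f = dfun (\<tau> K) (dfun (\<tau> K) f) - cscale (\<sigma>\<^sup>2) f"

definition Rop_inv ::
  "nat \<Rightarrow> (nat \<Rightarrow> real) \<Rightarrow> (int \<Rightarrow> real ^ 'm ^ 'm) \<Rightarrow> complex
     \<Rightarrow> (real \<Rightarrow> complex ^ 'm::finite) \<Rightarrow> real \<Rightarrow> complex ^ 'm" where
  "Rop_inv K \<tau> H \<sigma> = the_inv_into (Rop_dom K \<tau> H) (Rop K \<tau> \<sigma>)"

definition krylov ::
  "nat \<Rightarrow> ((real \<Rightarrow> complex ^ 'm) \<Rightarrow> real \<Rightarrow> complex ^ 'm) \<Rightarrow> (real \<Rightarrow> complex ^ 'm::finite)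
     \<Rightarrow> (real \<Rightarrow> complex ^ 'm) set" where
  "krylov m A f = cfun.span ((\<lambda>j. (A ^^ j) f) ` {..<m})"

end

theory Submission
  imports Defs
begin

text \<open>
  The eigenfunctions for \<open>\<lambda>\<close> and \<open>-\<lambda>\<close> are eigenvectors of the inverse of \<open>\<R>\<^sub>\<sigma>\<close> for one and the
  same eigenvalue \<open>1 / (\<lambda>\<^sup>2 - \<sigma>\<^sup>2)\<close>, because \<open>\<R>\<^sub>\<sigma>\<close> acts on an eigenfunction of \<open>\<H>\<close> through
  the square of the eigenvalue. Hence their whole span lies in a single eigenspace, and it is enough
  that a Krylov subspace meets an eigenspace in at most a line.

  This last fact is pure linear algebra (\<open>krylov_eigenspace_subset_line\<close>). Let \<open>A\<close> be linear. If
  \<open>A\<^sup>m v\<close> lies outside the span of the previous iterates, then that span contains no eigenvector at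
  all: an eigenvector would give a linear relation with which the Krylov subspaces stop growing. So
  an eigenvector involves the last independent iterate, and two of them for the same eigenvalue are
  proportional, since the combination of them without that iterate vanishes.

  To apply this, the inverse of \<open>\<R>\<^sub>\<sigma>\<close> has to be a linear map on the whole function space, that is,
  \<open>\<R>\<^sub>\<sigma> = (\<H> - \<sigma>)(\<H> + \<sigma>)\<close> has to be bijective from its domain (\<open>Rop_bij_betw\<close>). For \<open>s\<close>
  not an eigenvalue, \<open>\<H> - s\<close> is inverted by variation of constants, where the coupling condition
  at \<open>0\<close> becomes a linear system with the characteristic matrix \<open>M(s)\<close>
  (\<open>Hop_minus_cscale_surj\<close>). That \<open>-\<sigma>\<close> is not an eigenvalue either is where the Hamiltonian
  structure is used: \<open>(J M(s))\<^sup>T = J M(-s)\<close>, so the spectrum is symmetric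
  (\<open>Hop_eigenvalue_minus_iff\<close>).
\<close>

section \<open>Eigenvectors in Krylov subspaces\<close>

context vector_space
begin

text \<open>
  An eigenvector in the span of the first \<open>m\<close> iterates of \<open>v\<close> has the form \<open>p(A) v\<close> with a
  polynomial \<open>p\<close> of degree less than \<open>m\<close>, and \<open>(A - \<mu>) p(A) v = 0\<close>. The factor \<open>A - \<mu>\<close>
  raises the degree by one and keeps the leading coefficient, so this expresses an iterate of index
  at most \<open>m\<close> by the earlier ones; from there on the spans are constant. Linearity is asked on an
  invariant subspace \<open>V\<close> because the operator to which this is applied is meaningful only on the
  function space, a proper subspace of its type.
\<close>

lemma krylov_stagnates:
  assumes V: "subspace V" "v \<in> V" "\<And>x. x \<in> V \<Longrightarrow> A x \<in> V"
    and add: "\<And>x y. x \<in> V \<Longrightarrow> y \<in> V \<Longrightarrow> A (x + y) = A x + A y"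
    and scale: "\<And>c x. x \<in> V \<Longrightarrow> A (scale c x) = scale c (A x)"
    and x: "x \<in> span ((\<lambda>j. (A ^^ j) v) ` {..<m})" "x \<noteq> 0" "A x = scale \<mu> x"
  shows "(A ^^ m) v \<in> span ((\<lambda>j. (A ^^ j) v) ` {..<m})"
  using x(1)
proof (induction m)
  case 0
  with x(2) show ?case by simp
next
  case (Suc m)
  define s where "s j = (A ^^ j) v" for j
  have s_Suc: "s (Suc j) = A (s j)" for j
    by (simp add: s_def)
  have sV: "s j \<in> V" for j
    by (induction j) (simp_all add: s_def V)
  have span_V: "span (s ` {..<j}) \<subseteq> V" for j
    using sV V(1) by (intro span_minimal) auto
  have mono: "span (s ` {..<j}) \<subseteq> span (s ` {..<Suc j})" for j
    by (intro span_mono) auto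
  have A_span: "A y \<in> span (s ` {..<Suc j})" if "y \<in> span (s ` {..<j})" for y j
  proof -
    have "y \<in> V \<and> A y \<in> span (s ` {..<Suc j})"
      using that
    proof (induction rule: span_induct_alt)
      case base
      have "A 0 = 0"
        using scale[of 0 0] subspace_0[OF V(1)] by simp
      then show ?case
        using subspace_0[OF V(1)] span_zero by simp
    next
      case (step c a b)
      then obtain i where i: "i < j" "a = s i" by auto
      have "A a \<in> span (s ` {..<Suc j})"
        using i by (auto simp flip: s_Suc intro!: span_base)
      moreover have "scale c a \<in> V"
        using sV i V(1) subspace_scale by blast
      ultimately show ?case
        using step i sV add scale V(1)
        by (auto intro!: span_add span_scale subspace_add)
    qed
    then show ?thesis by blast
  qed
  have IH: "x \<in> span (s ` {..<m}) \<Longrightarrow> s m \<in> span (s ` {..<m})"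
    using Suc.IH by (simp add: s_def)
  have x_span: "x \<in> span (insert (s m) (s ` {..<m}))"
    using Suc.prems by (simp add: s_def lessThan_Suc)
  then obtain c where c: "x - scale c (s m) \<in> span (s ` {..<m})"
    by (auto simp: span_breakdown_eq)
  have "s (Suc m) \<in> span (s ` {..<Suc m})"
  proof (cases "c = 0")
    case True
    then show ?thesis
      using A_span[of "s m" m] c IH by (simp add: s_Suc)
  next
    case False
    \<comment> \<open>The \<open>m\<close>-th iterate occurs in \<open>x\<close>, so \<open>A x = \<mu> x\<close> can be solved for the next one.\<close>
    define y where "y = x - scale c (s m)"
    have y: "y \<in> span (s ` {..<m})" "x = scale c (s m) + y"
      using c by (simp_all add: y_def)
    have "A x = A (scale c (s m)) + A y"
      unfolding y(2) using y(1) span_V[of m] sV[of m] V(1) by (intro add subspace_scale) auto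
    then have "scale \<mu> x = scale c (s (Suc m)) + A y"
      by (simp add: x(3) scale sV s_Suc)
    then have "s (Suc m) = scale (1 / c) (scale \<mu> x - A y)"
      using False by simp
    moreover have "scale \<mu> x - A y \<in> span (s ` {..<Suc m})"
      using x_span A_span[OF y(1)] by (auto intro!: span_diff span_scale simp: lessThan_Suc)
    ultimately show ?thesis
      by (simp add: span_scale)
  qed
  then show ?case
    by (simp add: s_def)
qed

text \<open>
  Induction on \<open>m\<close>, where only a growing subspace matters. When the \<open>m\<close>-th iterate enlarges
  the Krylov subspace, the smaller one holds no eigenvector by \<open>krylov_stagnates\<close>. Two eigenvectors
  in the larger one then have nonzero components along the new iterate, and the combination that
  cancels these components is an eigenvector in the smaller one unless it vanishes, so it is zero.
\<close>

lemma krylov_eigenspace_subset_line: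
  assumes V: "subspace V" "v \<in> V" "\<And>x. x \<in> V \<Longrightarrow> A x \<in> V"
    and add: "\<And>x y. x \<in> V \<Longrightarrow> y \<in> V \<Longrightarrow> A (x + y) = A x + A y"
    and scale: "\<And>c x. x \<in> V \<Longrightarrow> A (scale c x) = scale c (A x)"
  obtains w where
    "{x \<in> span ((\<lambda>j. (A ^^ j) v) ` {..<m}). A x = scale \<mu> x} \<subseteq> span {w}"
proof -
  define S where "S m = span ((\<lambda>j. (A ^^ j) v) ` {..<m})" for m
  have sV: "(A ^^ j) v \<in> V" for j
    by (induction j) (simp_all add: V)
  have SV: "S m \<subseteq> V" for m
    unfolding S_def using sV V(1) by (intro span_minimal) auto
  have S_Suc: "S (Suc m) = span (insert ((A ^^ m) v) ((\<lambda>j. (A ^^ j) v) ` {..<m}))" for m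
    by (simp add: S_def lessThan_Suc)
  have "\<exists>w. {x \<in> S m. A x = scale \<mu> x} \<subseteq> span {w}"
  proof (induction m)
    case 0
    then show ?case
      by (auto simp: S_def span_zero)
  next
    case (Suc m)
    show ?case
    proof (cases "(A ^^ m) v \<in> S m")
      case True
      then have "S (Suc m) = S m"
        unfolding S_Suc by (simp add: S_def span_redundant)
      with Suc show ?thesis by simp
    next
      case False
      have triv: "x = 0" if "x \<in> S m" "A x = scale \<mu> x" for x
        using False krylov_stagnates[OF assms, of x m \<mu>] that by (auto simp: S_def)
      show ?thesis
      proof (cases "\<exists>x \<in> S (Suc m). A x = scale \<mu> x \<and> x \<noteq> 0")
        case False
        then show ?thesis
          by (intro exI[of _ 0]) (auto simp: span_zero)
      next
        case True
        then obtain x where x: "x \<in> S (Suc m)" "A x = scale \<mu> x" "x \<noteq> 0"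
          by blast
        then obtain c where c: "x - scale c ((A ^^ m) v) \<in> S m"
          unfolding S_Suc by (auto simp: span_breakdown_eq S_def)
        have "c \<noteq> 0"
          using c triv x(2,3) by auto
        have "u \<in> span {x}" if u: "u \<in> S (Suc m)" "A u = scale \<mu> u" for u
        proof -
          obtain d where d: "u - scale d ((A ^^ m) v) \<in> S m"
            using u(1) unfolding S_Suc by (auto simp: span_breakdown_eq S_def)
          \<comment> \<open>This multiple cancels the component along the last Krylov vector.\<close>
          define k where "k = - (d / c)"
          have "u + scale k x = (u - scale d ((A ^^ m) v)) + scale k (x - scale c ((A ^^ m) v))"
            using \<open>c \<noteq> 0\<close> by (simp add: k_def scale_right_diff_distrib)
          also have "\<dots> \<in> S m"
            using c d unfolding S_def by (intro span_add span_scale)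
          finally have "u + scale k x \<in> S m" .
          moreover have "A (u + scale k x) = scale \<mu> (u + scale k x)"
          proof -
            have uV: "u \<in> V" and xV: "x \<in> V"
              using u x SV by auto
            have "A (u + scale k x) = A u + scale k (A x)"
              using uV xV V(1) by (simp add: add scale subspace_scale)
            then show ?thesis
              using u(2) x(2) by (simp add: scale_right_distrib scale_left_commute)
          qed
          ultimately have "u + scale k x = 0"
            by (rule triv)
          then have "u = scale (- k) x"
            by (simp add: eq_neg_iff_add_eq_0)
          then show ?thesis
            unfolding span_singleton by blast
        qed
        then show ?thesis by blast
      qed
    qed
  qed
  then show ?thesis
    using that unfolding S_def by blast
qed

end

section \<open>Differentiation on a symmetric interval\<close>

lemma bounded_bilinear_vec_scale:
  "bounded_bilinear ((*s) :: complex \<Rightarrow> complex ^ 'm::finite \<Rightarrow> complex ^ 'm)"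
  by (subst bilinear_conv_bounded_bilinear [symmetric])
    (auto simp: bilinear_def vec_eq_iff algebra_simps intro!: linearI)

lemma subspace_cfun_space: "cfun.subspace (cfun_space r)"
proof -
  have "continuous_on A (\<lambda>t. c *s f t)" if "continuous_on A f"
    for c :: complex and A and f :: "real \<Rightarrow> complex ^ 'm"
    using bounded_bilinear.continuous_on[OF bounded_bilinear_vec_scale continuous_on_const that] .
  then show ?thesis
    by (auto simp: cfun.subspace_def cfun_space_def cscale_def zero_fun_def plus_fun_def
        intro: continuous_on_add)
qed

lemma c1fun_spaceI:
  assumes "0 < r" and "g \<in> cfun_space r" and "\<And>t. t \<notin> {-r..r} \<Longrightarrow> f t = 0"
    and deriv: "\<And>t. t \<in> {-r..r} \<Longrightarrow> (f has_vector_derivative g t) (at t within {-r..r})"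
  shows "f \<in> c1fun_space r" and "dfun r f = g"
proof -
  show eq: "dfun r f = g"
  proof
    fix t
    show "dfun r f t = g t"
    proof (cases "t \<in> {-r..r}")
      case True
      then show ?thesis
        unfolding dfun_def using assms(1) deriv[OF True]
        by (simp add: vector_derivative_within_closed_interval)
    next
      case False
      then show ?thesis
        using assms(2) by (auto simp: dfun_def cfun_space_def)
    qed
  qed
  have "f differentiable_on {-r..r}"
    using deriv unfolding differentiable_on_def
    by (meson differentiableI has_vector_derivative_def)
  then show "f \<in> c1fun_space r"
    using assms(2,3) eq differentiable_imp_continuous_on[of f "{-r..r}"]
    by (simp add: c1fun_space_def cfun_space_def)
qed

lemma c1fun_space_has_vector_derivative:
  assumes "f \<in> c1fun_space r" and "t \<in> {-r..r}"
  shows "(f has_vector_derivative dfun r f t) (at t within {-r..r})"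
  using assms
  by (auto simp: c1fun_space_def differentiable_on_def dfun_def vector_derivative_works)

lemma
  assumes "0 < r" and f: "f \<in> c1fun_space r" and g: "g \<in> c1fun_space r"
  shows c1fun_space_add: "f + g \<in> c1fun_space r"
    and dfun_add: "dfun r (f + g) = dfun r f + dfun r g"
proof -
  have d: "((f + g) has_vector_derivative (dfun r f + dfun r g) t) (at t within {-r..r})"
    if "t \<in> {-r..r}" for t
    unfolding plus_fun_def using f g that
    by (intro has_vector_derivative_add c1fun_space_has_vector_derivative)
  have c: "dfun r f + dfun r g \<in> cfun_space r"
    using f g cfun.subspace_add[OF subspace_cfun_space] by (auto simp: c1fun_space_def)
  have z: "(f + g) t = 0" if "t \<notin> {-r..r}" for t
    using f g that by (auto simp: c1fun_space_def cfun_space_def)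
  show "f + g \<in> c1fun_space r" "dfun r (f + g) = dfun r f + dfun r g"
    using c1fun_spaceI[OF assms(1) c z d] by auto
qed

lemma
  assumes "0 < r" and f: "f \<in> c1fun_space r"
  shows c1fun_space_cscale: "cscale c f \<in> c1fun_space r"
    and dfun_cscale: "dfun r (cscale c f) = cscale c (dfun r f)"
proof -
  have d: "(cscale c f has_vector_derivative cscale c (dfun r f) t) (at t within {-r..r})"
    if "t \<in> {-r..r}" for t
    unfolding cscale_def using f that
    by (intro bounded_linear.has_vector_derivative
        [OF bounded_bilinear.bounded_linear_right[OF bounded_bilinear_vec_scale]]
        c1fun_space_has_vector_derivative)
  have cs: "cscale c (dfun r f) \<in> cfun_space r"
    using f cfun.subspace_scale[OF subspace_cfun_space] by (auto simp: c1fun_space_def)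
  have z: "cscale c f t = 0" if "t \<notin> {-r..r}" for t
    using f that by (auto simp: c1fun_space_def cfun_space_def cscale_def)
  show "cscale c f \<in> c1fun_space r" "dfun r (cscale c f) = cscale c (dfun r f)"
    using c1fun_spaceI[OF assms(1) cs z d] by auto
qed

lemma subspace_c1fun_space:
  assumes "0 < r" shows "cfun.subspace (c1fun_space r)"
proof -
  have "0 \<in> c1fun_space r"
    using cfun.subspace_0[OF subspace_cfun_space, of r]
    by (intro c1fun_spaceI[OF assms]) (auto simp: zero_fun_def)
  then show ?thesis
    using assms by (simp add: cfun.subspace_def c1fun_space_add c1fun_space_cscale)
qed

section \<open>First-order equations\<close>

lemma has_vector_derivative_exp_vec_scale:
  fixes s :: complex and f :: "real \<Rightarrow> complex ^ 'm::finite"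
  assumes "(f has_vector_derivative f') (at t within S)"
  shows "((\<lambda>t. exp (s * of_real t) *s f t) has_vector_derivative
           s *s (exp (s * of_real t) *s f t) + exp (s * of_real t) *s f') (at t within S)"
proof -
  have "((\<lambda>t. exp (s * complex_of_real t)) has_vector_derivative s * exp (s * of_real t)) (at t within S)"
    by (rule has_vector_derivative_real_field[where f = "\<lambda>z. exp (s * z)"])
      (auto intro!: derivative_eq_intros)
  from bounded_bilinear.has_vector_derivative[OF bounded_bilinear_vec_scale this assms]
  show ?thesis
    by (simp add: add.commute)
qed

text \<open>
  The solution of \<open>f' = s f\<close> with value \<open>c\<close> at \<open>0\<close>, extended by zero as the elements of
  the function space are.
\<close>

definition exp_solution :: "real \<Rightarrow> complex \<Rightarrow> complex ^ 'm::finite \<Rightarrow> real \<Rightarrow> complex ^ 'm" where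
  "exp_solution r s c = (\<lambda>t. if t \<in> {-r..r} then exp (s * of_real t) *s c else 0)"

text \<open>
  Variation of constants. The integral starts at the left end point, where the one-sided fundamental
  theorem of calculus applies directly; the value of \<open>p\<close> at \<open>0\<close> is corrected later by adding an
  exponential.
\<close>

lemma first_order_solution:
  fixes y :: "real \<Rightarrow> complex ^ 'm::finite"
  assumes "0 < r" and y: "y \<in> cfun_space r"
  obtains p where "p \<in> c1fun_space r" "dfun r p = cscale s p + y"
proof -
  define q where "q t = exp (- s * of_real t) *s y t" for t
  have "continuous_on {-r..r} q"
    unfolding q_def using y
    by (intro bounded_bilinear.continuous_on[OF bounded_bilinear_vec_scale] continuous_intros)
      (auto simp: cfun_space_def)
  note Q = integral_has_vector_derivative[OF this]
  define p where "p t = (if t \<in> {-r..r} then exp (s * of_real t) *s integral {-r..t} q else 0)" for t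
  have deriv: "(p has_vector_derivative (cscale s p + y) t) (at t within {-r..r})"
    if t: "t \<in> {-r..r}" for t
  proof -
    have "exp (s * of_real t) *s q t = y t"
      by (simp add: q_def vec_eq_iff mult.assoc[symmetric] exp_minus)
    then have "s *s (exp (s * of_real t) *s integral {-r..t} q) + exp (s * of_real t) *s q t
        = (cscale s p + y) t"
      using t by (simp add: cscale_def p_def)
    then show ?thesis
      using has_vector_derivative_exp_vec_scale[OF Q[OF t], of s] t
      by (intro has_vector_derivative_transform[OF t, of p]) (auto simp: p_def)
  qed
  have "continuous_on {-r..r} p"
    using deriv by (rule continuous_on_vector_derivative)
  then have "p \<in> cfun_space r"
    by (auto simp: cfun_space_def p_def)
  then have "cscale s p + y \<in> cfun_space r"
    using y by (intro cfun.subspace_add[OF subspace_cfun_space]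
        cfun.subspace_scale[OF subspace_cfun_space])
  then show ?thesis
    using c1fun_spaceI[OF assms(1) _ _ deriv] that by (metis p_def)
qed

lemma
  assumes "0 < r"
  shows exp_solution_in_c1fun_space: "exp_solution r s c \<in> c1fun_space r"
    and dfun_exp_solution: "dfun r (exp_solution r s c) = cscale s (exp_solution r s c)"
proof -
  have deriv: "(exp_solution r s c has_vector_derivative cscale s (exp_solution r s c) t)
      (at t within {-r..r})" if t: "t \<in> {-r..r}" for t
    using has_vector_derivative_exp_vec_scale[OF has_vector_derivative_const, of s c t] t
    by (intro has_vector_derivative_transform[OF t, of "exp_solution r s c"])
      (auto simp: exp_solution_def cscale_def)
  have "continuous_on {-r..r} (exp_solution r s c)"
    using deriv by (rule continuous_on_vector_derivative)
  then have "exp_solution r s c \<in> cfun_space r"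
    by (auto simp: cfun_space_def exp_solution_def)
  then have "cscale s (exp_solution r s c) \<in> cfun_space r"
    by (intro cfun.subspace_scale[OF subspace_cfun_space])
  moreover have "exp_solution r s c t = 0" if "t \<notin> {-r..r}" for t
    using that by (simp add: exp_solution_def del: atLeastAtMost_iff)
  ultimately show "exp_solution r s c \<in> c1fun_space r"
    "dfun r (exp_solution r s c) = cscale s (exp_solution r s c)"
    using c1fun_spaceI[OF assms _ _ deriv] by blast+
qed

text \<open>The product of \<open>f\<close> with the integrating factor \<open>exp (- s t)\<close> has derivative zero.\<close>

lemma homogeneous_solution_unique:
  assumes "0 < r" and f: "f \<in> c1fun_space r" and eq: "dfun r f = cscale s f"
  shows "f = exp_solution r s (f 0)"
proof -
  have "((\<lambda>t. exp (- s * of_real t) *s f t) has_vector_derivative 0) (at t within {-r..r})"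
    if t: "t \<in> {-r..r}" for t
  proof -
    have "- s *s (exp (- s * of_real t) *s f t) + exp (- s * of_real t) *s dfun r f t = 0"
      by (simp add: eq cscale_def vec_eq_iff)
    then show ?thesis
      using has_vector_derivative_exp_vec_scale
        [OF c1fun_space_has_vector_derivative[OF f t], of "- s"] by simp
  qed
  then obtain c where c: "\<And>t. t \<in> {-r..r} \<Longrightarrow> exp (- s * of_real t) *s f t = c"
    using has_vector_derivative_zero_constant[OF convex_real_interval(5)] by blast
  have f_eq: "f t = exp (s * of_real t) *s c" if "t \<in> {-r..r}" for t
    unfolding c[OF that, symmetric]
    by (simp add: vec_eq_iff mult.assoc[symmetric] exp_minus)
  moreover have "f 0 = c"
    using f_eq[of 0] assms(1) by simp
  ultimately show ?thesis
    using f by (auto simp: fun_eq_iff exp_solution_def c1fun_space_def cfun_space_def)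
qed

section \<open>The spectrum\<close>

lemma coupling_add: "coupling K \<tau> H (f + g) = coupling K \<tau> H f + coupling K \<tau> H g"
  by (simp add: coupling_def matrix_vector_right_distrib sum.distrib algebra_simps)

lemma coupling_cscale: "coupling K \<tau> H (cscale c f) = c *s coupling K \<tau> H f"
  by (simp add: coupling_def cscale_def matrix_vector_mult_scaleR vec.scale vec.scale_sum_right
      vec.scale_right_distrib vector_scalar_commute)

locale delay_equation =
  fixes K :: nat and \<tau> :: "nat \<Rightarrow> real" and H :: "int \<Rightarrow> real ^ 'm::finite ^ 'm"
  assumes delays_range: "\<tau> ` {1..K} \<subseteq> {0..\<tau> K}" and pos: "0 < \<tau> K"
begin

text \<open>
  The characteristic matrix is the defect of an exponential in the coupling condition at \<open>0\<close>.
  Through this identity, the analysis of the differential operator reduces to linear algebra in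
  finite dimension.
\<close>

lemma char_matrix_mult:
  "char_matrix K \<tau> H s *v c = s *s c - coupling K \<tau> H (exp_solution (\<tau> K) s c)"
proof (subst vec_eq_iff, intro allI)
  fix i
  have "(char_matrix K \<tau> H s *v c) $ i
      = (\<Sum>j\<in>UNIV. (mat s :: complex ^ _ ^ _) $ i $ j * c $ j)
        - (\<Sum>j\<in>UNIV. of_real (H 0 $ i $ j) * c $ j)
        - (\<Sum>k=1..K. (\<Sum>j\<in>UNIV. of_real (H (- int k) $ i $ j) * (exp (- s * of_real (\<tau> k)) * c $ j))
           + (\<Sum>j\<in>UNIV. of_real (H (int k) $ i $ j) * (exp (s * of_real (\<tau> k)) * c $ j)))"
    unfolding char_matrix_def matrix_vector_mult_def
    by (simp add: left_diff_distrib sum_subtractf sum_distrib_right distrib_right mult.assoc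
        sum.swap[of _ UNIV] flip: sum.distrib)
  also have "(\<Sum>j\<in>UNIV. (mat s :: complex ^ _ ^ _) $ i $ j * c $ j) = s * c $ i"
    by (simp add: mat_def if_distrib[of "\<lambda>x. x * _"] cong: if_cong)
  also have "(\<Sum>k=1..K. (\<Sum>j\<in>UNIV. of_real (H (- int k) $ i $ j) * (exp (- s * of_real (\<tau> k)) * c $ j))
           + (\<Sum>j\<in>UNIV. of_real (H (int k) $ i $ j) * (exp (s * of_real (\<tau> k)) * c $ j)))
     = (\<Sum>k=1..K. cmat (H (- int k)) *v exp_solution (\<tau> K) s c (- \<tau> k)
                  + cmat (H (int k)) *v exp_solution (\<tau> K) s c (\<tau> k)) $ i"
    unfolding sum_component
  proof (intro sum.cong refl)
    fix k assume "k \<in> {1..K}"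
    then have "\<tau> k \<in> {0..\<tau> K}"
      using delays_range by blast
    then have "\<tau> k \<in> {- \<tau> K..\<tau> K}" "- \<tau> k \<in> {- \<tau> K..\<tau> K}"
      by auto
    then show "(\<Sum>j\<in>UNIV. of_real (H (- int k) $ i $ j) * (exp (- s * of_real (\<tau> k)) * c $ j))
           + (\<Sum>j\<in>UNIV. of_real (H (int k) $ i $ j) * (exp (s * of_real (\<tau> k)) * c $ j))
        = (cmat (H (- int k)) *v exp_solution (\<tau> K) s c (- \<tau> k)
                  + cmat (H (int k)) *v exp_solution (\<tau> K) s c (\<tau> k)) $ i"
      by (simp add: exp_solution_def matrix_vector_mult_def del: atLeastAtMost_iff)
  qed
  finally show "(char_matrix K \<tau> H s *v c) $ i
      = (s *s c - coupling K \<tau> H (exp_solution (\<tau> K) s c)) $ i"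
    using pos by (simp add: coupling_def exp_solution_def matrix_vector_mult_def)
qed

text \<open>
  The eigenfunctions are the exponentials whose coefficient vector makes the defect vanish.
\<close>

lemma Hop_eigenvalue_iff:
  "Hop_eigenvalue K \<tau> H s \<longleftrightarrow> (\<exists>c. c \<noteq> 0 \<and> char_matrix K \<tau> H s *v c = 0)"
proof
  assume "Hop_eigenvalue K \<tau> H s"
  then obtain f where f: "f \<in> c1fun_space (\<tau> K)" "dfun (\<tau> K) f 0 = coupling K \<tau> H f" "f \<noteq> 0"
      "dfun (\<tau> K) f = cscale s f"
    by (auto simp: Hop_eigenvalue_def Hop_eigenfunction_def Hop_dom_def Hop_def)
  have f_eq: "f = exp_solution (\<tau> K) s (f 0)"
    using homogeneous_solution_unique[OF pos f(1,4)] .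
  have "char_matrix K \<tau> H s *v f 0 = 0"
    unfolding char_matrix_mult f_eq[symmetric]
    using f(2,4) by (simp add: cscale_def)
  moreover have "f 0 \<noteq> 0"
  proof
    assume "f 0 = 0"
    then have "f = 0"
      by (subst f_eq) (simp add: exp_solution_def fun_eq_iff)
    with f(3) show False by simp
  qed
  ultimately show "\<exists>c. c \<noteq> 0 \<and> char_matrix K \<tau> H s *v c = 0" by blast
next
  assume "\<exists>c. c \<noteq> 0 \<and> char_matrix K \<tau> H s *v c = 0"
  then obtain c where c: "c \<noteq> 0" "char_matrix K \<tau> H s *v c = 0" by blast
  define f where "f = exp_solution (\<tau> K) s c"
  have f: "f \<in> c1fun_space (\<tau> K)" "dfun (\<tau> K) f = cscale s f"
    using exp_solution_in_c1fun_space[OF pos] dfun_exp_solution[OF pos] by (auto simp: f_def)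
  have f0: "f 0 = c"
    using pos by (simp add: f_def exp_solution_def)
  moreover have "coupling K \<tau> H f = s *s c"
    using c(2) pos by (simp add: char_matrix_mult f_def)
  moreover have "f \<noteq> 0"
    using f0 c(1) by auto
  ultimately have "Hop_eigenfunction K \<tau> H s f"
    using f by (simp add: Hop_eigenfunction_def Hop_dom_def Hop_def cscale_def)
  then show "Hop_eigenvalue K \<tau> H s"
    by (auto simp: Hop_eigenvalue_def)
qed

section \<open>The resolvent and the inverse of the shifted square\<close>

lemma subspace_Hop_dom:
  "cfun.subspace (Hop_dom K \<tau> H)"
proof -
  have sub: "cfun.subspace (c1fun_space (\<tau> K))"
    using subspace_c1fun_space[OF pos] .
  have "f + g \<in> Hop_dom K \<tau> H" if "f \<in> Hop_dom K \<tau> H" "g \<in> Hop_dom K \<tau> H" for f g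
    using that pos by (simp add: Hop_dom_def c1fun_space_add dfun_add coupling_add)
  moreover have "cscale c f \<in> Hop_dom K \<tau> H" if "f \<in> Hop_dom K \<tau> H" for c f
    using that pos by (simp add: Hop_dom_def c1fun_space_cscale dfun_cscale coupling_cscale)
      (simp add: cscale_def)
  moreover have "0 \<in> Hop_dom K \<tau> H"
  proof -
    have "dfun (\<tau> K) (0 :: real \<Rightarrow> complex ^ 'm) = 0"
      using dfun_cscale[OF pos cfun.subspace_0[OF sub], of 0] by simp
    then show ?thesis
      using cfun.subspace_0[OF sub]
      by (simp add: Hop_dom_def coupling_def)
  qed
  ultimately show ?thesis
    by (simp add: cfun.subspace_def)
qed

lemmas Hop_dom_closed =
  subspace_Hop_dom[THEN cfun.subspace_0] subspace_Hop_dom[THEN cfun.subspace_add]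
  subspace_Hop_dom[THEN cfun.subspace_diff] subspace_Hop_dom[THEN cfun.subspace_scale]

lemma Hop_add:
  assumes "f \<in> Hop_dom K \<tau> H" and "g \<in> Hop_dom K \<tau> H"
  shows "Hop K \<tau> (f + g) = Hop K \<tau> f + Hop K \<tau> g"
  using assms pos by (simp add: Hop_def Hop_dom_def dfun_add)

lemma Hop_cscale:
  assumes "f \<in> Hop_dom K \<tau> H"
  shows "Hop K \<tau> (cscale c f) = cscale c (Hop K \<tau> f)"
  using assms pos by (simp add: Hop_def Hop_dom_def dfun_cscale)

text \<open>
  Adding an exponential with initial value \<open>c\<close> to a particular solution of \<open>f' = s f + y\<close> changes
  the defect in the coupling condition by the characteristic matrix applied to \<open>c\<close>. As \<open>s\<close> is
  not an eigenvalue, this matrix is invertible and the defect can be removed.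
\<close>

lemma Hop_minus_cscale_surj:
  assumes s: "\<not> Hop_eigenvalue K \<tau> H s" and y: "y \<in> cfun_space (\<tau> K)"
  obtains f where "f \<in> Hop_dom K \<tau> H" "Hop K \<tau> f - cscale s f = y"
proof -
  obtain p where p: "p \<in> c1fun_space (\<tau> K)" "dfun (\<tau> K) p = cscale s p + y"
    using first_order_solution[OF pos y] .
  let ?M = "char_matrix K \<tau> H s"
  have "\<forall>c. ?M *v c = 0 \<longrightarrow> c = 0"
    using s Hop_eigenvalue_iff by blast
  then obtain B where "?M ** B = mat 1"
    by (metis matrix_left_invertible_ker matrix_left_right_inverse)
  then obtain c where c: "?M *v c = coupling K \<tau> H p - (s *s p 0 + y 0)"
    by (metis matrix_vector_mul_assoc matrix_vector_mul_lid)
  define e where "e = exp_solution (\<tau> K) s c"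
  have e: "e \<in> c1fun_space (\<tau> K)" "dfun (\<tau> K) e = cscale s e"
    using exp_solution_in_c1fun_space[OF pos] dfun_exp_solution[OF pos] by (auto simp: e_def)
  have d: "dfun (\<tau> K) (e + p) = cscale s (e + p) + y"
    using p e pos by (simp add: dfun_add cfun.scale_right_distrib)
  have "e 0 = c"
    using pos by (simp add: e_def exp_solution_def)
  then have "cscale s e 0 + cscale s p 0 + y 0 = coupling K \<tau> H e + coupling K \<tau> H p"
    using c pos by (simp add: char_matrix_mult e_def cscale_def algebra_simps)
  then have "e + p \<in> Hop_dom K \<tau> H"
    using p e pos by (simp add: Hop_dom_def c1fun_space_add dfun_add coupling_add add.assoc)
  with d show ?thesis
    by (intro that[of "e + p"]) (simp_all add: Hop_def)
qed

lemma Hop_eq_cscale_imp_0: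
  assumes "\<not> Hop_eigenvalue K \<tau> H s" and "f \<in> Hop_dom K \<tau> H" and "Hop K \<tau> f = cscale s f"
  shows "f = 0"
  using assms by (auto simp: Hop_eigenvalue_def Hop_eigenfunction_def)

lemma Rop_dom_iff: "f \<in> Rop_dom K \<tau> H \<longleftrightarrow> f \<in> Hop_dom K \<tau> H \<and> Hop K \<tau> f \<in> Hop_dom K \<tau> H"
  by (auto simp: Rop_dom_def Hop_dom_def Hop_def)

lemma Rop_eq: "Rop K \<tau> \<sigma> f = Hop K \<tau> (Hop K \<tau> f) - cscale (\<sigma>\<^sup>2) f"
  by (simp add: Rop_def Hop_def)

lemma subspace_Rop_dom:
  "cfun.subspace (Rop_dom K \<tau> H)"
proof -
  have "Hop K \<tau> (0 :: real \<Rightarrow> complex ^ 'm) = 0"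
    using Hop_cscale[OF Hop_dom_closed(1), of 0] by simp
  then show ?thesis
    unfolding cfun.subspace_def
    by (auto simp: Rop_dom_iff Hop_add Hop_cscale Hop_dom_closed simp del: cfun.scale_eq_0_iff)
qed

lemma Rop_add:
  assumes "f \<in> Rop_dom K \<tau> H" and "g \<in> Rop_dom K \<tau> H"
  shows "Rop K \<tau> \<sigma> (f + g) = Rop K \<tau> \<sigma> f + Rop K \<tau> \<sigma> g"
  using assms unfolding Rop_eq Rop_dom_iff
  by (simp add: Hop_add cfun.scale_right_distrib)

lemma Rop_cscale:
  assumes "f \<in> Rop_dom K \<tau> H"
  shows "Rop K \<tau> \<sigma> (cscale c f) = cscale c (Rop K \<tau> \<sigma> f)"
  using assms unfolding Rop_eq Rop_dom_iff
  by (simp add: Hop_cscale cfun.scale_right_diff_distrib mult.commute)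

text \<open>
  The operator is the composition of \<open>\<H> - \<sigma>\<close> and \<open>\<H> + \<sigma>\<close>, and its domain is exactly
  the natural domain of that composition. Both factors are bijections onto the function space.
\<close>

lemma Rop_bij_betw:
  assumes \<sigma>: "\<not> Hop_eigenvalue K \<tau> H \<sigma>" "\<not> Hop_eigenvalue K \<tau> H (- \<sigma>)"
  shows "bij_betw (Rop K \<tau> \<sigma>) (Rop_dom K \<tau> H) (cfun_space (\<tau> K))"
proof -
  have factor: "Rop K \<tau> \<sigma> f = Hop K \<tau> g - cscale \<sigma> g"
    if "f \<in> Rop_dom K \<tau> H" "g = Hop K \<tau> f + cscale \<sigma> f" for f g
    using that
    by (simp add: Hop_dom_closed Rop_eq Rop_dom_iff Hop_add Hop_cscale cfun.scale_right_distrib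
        power2_eq_square)
  have inj: "f = 0" if f: "f \<in> Rop_dom K \<tau> H" "Rop K \<tau> \<sigma> f = 0" for f
  proof -
    define g where "g = Hop K \<tau> f + cscale \<sigma> f"
    have "g \<in> Hop_dom K \<tau> H"
      using f(1) by (simp add: g_def Rop_dom_iff Hop_dom_closed)
    then have "g = 0"
      using factor[OF f(1) g_def] f(2) by (intro Hop_eq_cscale_imp_0[OF \<sigma>(1)]) auto
    then have "Hop K \<tau> f = cscale (- \<sigma>) f"
      by (simp add: g_def eq_neg_iff_add_eq_0)
    with f(1) show ?thesis
      by (intro Hop_eq_cscale_imp_0[OF \<sigma>(2)]) (auto simp: Rop_dom_iff)
  qed
  have "inj_on (Rop K \<tau> \<sigma>) (Rop_dom K \<tau> H)"
  proof (rule inj_onI)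
    fix f g assume fg: "f \<in> Rop_dom K \<tau> H" "g \<in> Rop_dom K \<tau> H" "Rop K \<tau> \<sigma> f = Rop K \<tau> \<sigma> g"
    have g: "cscale (- 1) g \<in> Rop_dom K \<tau> H"
      using fg(2) by (rule cfun.subspace_scale[OF subspace_Rop_dom])
    have "Rop K \<tau> \<sigma> (f + cscale (- 1) g) = 0"
      unfolding Rop_add[OF fg(1) g] Rop_cscale[OF fg(2)] fg(3) by simp
    then have "f + cscale (- 1) g = 0"
      using inj cfun.subspace_add[OF subspace_Rop_dom fg(1) g] by blast
    then show "f = g"
      by simp
  qed
  moreover have "Rop K \<tau> \<sigma> f \<in> cfun_space (\<tau> K)" if "f \<in> Rop_dom K \<tau> H" for f
    using that unfolding Rop_def Rop_dom_def c1fun_space_def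
    by (simp add: cfun.subspace_diff[OF subspace_cfun_space]
        cfun.subspace_scale[OF subspace_cfun_space])
  moreover have "\<exists>f \<in> Rop_dom K \<tau> H. Rop K \<tau> \<sigma> f = y" if y: "y \<in> cfun_space (\<tau> K)" for y
  proof -
    obtain g where g: "g \<in> Hop_dom K \<tau> H" "Hop K \<tau> g - cscale \<sigma> g = y"
      using Hop_minus_cscale_surj[OF \<sigma>(1) y] .
    then have "g \<in> cfun_space (\<tau> K)"
      by (simp add: Hop_dom_def c1fun_space_def)
    then obtain f where f: "f \<in> Hop_dom K \<tau> H" "Hop K \<tau> f - cscale (- \<sigma>) f = g"
      using Hop_minus_cscale_surj[OF \<sigma>(2)] by blast
    have "Hop K \<tau> f = g - cscale \<sigma> f"
      using f(2) by (simp add: algebra_simps)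
    then have "Hop K \<tau> f \<in> Hop_dom K \<tau> H"
      using f(1) g(1) by (simp add: Hop_dom_closed)
    then have "f \<in> Rop_dom K \<tau> H"
      using f(1) by (simp add: Rop_dom_iff)
    with factor[OF this, of g] f(2) g(2) show ?thesis
      by auto
  qed
  ultimately show ?thesis
    by (auto simp: bij_betw_def)
qed

lemma Rop_inv_props:
  assumes bij: "bij_betw (Rop K \<tau> \<sigma>) (Rop_dom K \<tau> H) (cfun_space (\<tau> K))"
  shows Rop_inv_Rop: "f \<in> Rop_dom K \<tau> H \<Longrightarrow> Rop_inv K \<tau> H \<sigma> (Rop K \<tau> \<sigma> f) = f"
    and Rop_inv_in_cfun_space: "y \<in> cfun_space (\<tau> K) \<Longrightarrow> Rop_inv K \<tau> H \<sigma> y \<in> cfun_space (\<tau> K)"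
    and Rop_inv_add: "\<lbrakk>y \<in> cfun_space (\<tau> K); z \<in> cfun_space (\<tau> K)\<rbrakk>
      \<Longrightarrow> Rop_inv K \<tau> H \<sigma> (y + z) = Rop_inv K \<tau> H \<sigma> y + Rop_inv K \<tau> H \<sigma> z"
    and Rop_inv_cscale: "y \<in> cfun_space (\<tau> K)
      \<Longrightarrow> Rop_inv K \<tau> H \<sigma> (cscale c y) = cscale c (Rop_inv K \<tau> H \<sigma> y)"
proof -
  show inv: "Rop_inv K \<tau> H \<sigma> (Rop K \<tau> \<sigma> f) = f" if "f \<in> Rop_dom K \<tau> H" for f
    unfolding Rop_inv_def using bij that by (simp add: bij_betw_def the_inv_into_f_f)
  have preimage: "\<exists>f \<in> Rop_dom K \<tau> H. y = Rop K \<tau> \<sigma> f" if "y \<in> cfun_space (\<tau> K)" for y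
    using bij that by (auto simp: bij_betw_def)
  note S = subspace_Rop_dom
  show "Rop_inv K \<tau> H \<sigma> y \<in> cfun_space (\<tau> K)" if y: "y \<in> cfun_space (\<tau> K)" for y
    using preimage[OF y] inv by (auto simp: Rop_dom_def c1fun_space_def)
  show "Rop_inv K \<tau> H \<sigma> (y + z) = Rop_inv K \<tau> H \<sigma> y + Rop_inv K \<tau> H \<sigma> z"
    if yz: "y \<in> cfun_space (\<tau> K)" "z \<in> cfun_space (\<tau> K)" for y z
    using preimage[OF yz(1)] preimage[OF yz(2)] inv
    by (auto simp: cfun.subspace_add[OF S] simp flip: Rop_add)
  show "Rop_inv K \<tau> H \<sigma> (cscale c y) = cscale c (Rop_inv K \<tau> H \<sigma> y)"
    if y: "y \<in> cfun_space (\<tau> K)" for y c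
    using preimage[OF y] inv
    by (auto simp: cfun.subspace_scale[OF S] simp flip: Rop_cscale)
qed

lemma Rop_inv_eigenfunction:
  assumes bij: "bij_betw (Rop K \<tau> \<sigma>) (Rop_dom K \<tau> H) (cfun_space (\<tau> K))"
    and f: "Hop_eigenfunction K \<tau> H z f"
  shows "Rop_inv K \<tau> H \<sigma> f = cscale (1 / (z\<^sup>2 - \<sigma>\<^sup>2)) f"
proof -
  have f': "f \<in> Hop_dom K \<tau> H" "Hop K \<tau> f = cscale z f" "f \<noteq> 0"
    using f by (auto simp: Hop_eigenfunction_def)
  have dom: "f \<in> Rop_dom K \<tau> H"
    using f' subspace_Hop_dom by (simp add: Rop_dom_iff cfun.subspace_scale)
  have R: "Rop K \<tau> \<sigma> f = cscale (z\<^sup>2 - \<sigma>\<^sup>2) f"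
    using f' Hop_cscale[OF f'(1)]
    by (simp add: Rop_eq cfun.scale_left_diff_distrib power2_eq_square)
  note inv = Rop_inv_Rop[OF bij dom]
  have fX: "f \<in> cfun_space (\<tau> K)"
    using f'(1) by (simp add: Hop_dom_def c1fun_space_def)
  \<comment> \<open>Since \<open>f \<noteq> 0\<close>, this also shows \<open>z\<^sup>2 \<noteq> \<sigma>\<^sup>2\<close>.\<close>
  have *: "cscale (z\<^sup>2 - \<sigma>\<^sup>2) (Rop_inv K \<tau> H \<sigma> f) = f"
    using inv unfolding R Rop_inv_cscale[OF bij fX] .
  then have "z\<^sup>2 - \<sigma>\<^sup>2 \<noteq> 0"
    using f'(3) by auto
  with arg_cong[OF *, of "cscale (1 / (z\<^sup>2 - \<sigma>\<^sup>2))"] show ?thesis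
    by simp
qed

end

section \<open>Symmetry of the spectrum\<close>

text \<open>
  Left multiplication by \<open>J\<close> as a row operation. The structure condition on \<open>H\<close> concerns real
  matrices and the characteristic matrix is complex, so the entry type is left open.
\<close>

definition Jrows :: "'a::uminus ^ 'c ^ ('n::finite + 'n) \<Rightarrow> 'a ^ 'c ^ ('n + 'n)" where
  "Jrows A = (\<chi> i. case i of Inl a \<Rightarrow> A $ Inr a | Inr a \<Rightarrow> \<chi> j. - A $ Inl a $ j)"

lemma Jmat_mult:
  fixes A :: "real ^ 'c::finite ^ ('n::finite + 'n)"
  shows "Jmat ** A = Jrows A"
proof (subst vec_eq_iff, subst vec_eq_iff, intro allI)
  fix i :: "'n + 'n" and j
  have univ: "(UNIV :: ('n + 'n) set) = Inl ` UNIV \<union> Inr ` UNIV"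
    by (auto simp: UNIV_sum)
  have split: "(\<Sum>l\<in>UNIV. g l) = (\<Sum>a\<in>UNIV. g (Inl a)) + (\<Sum>a\<in>UNIV. g (Inr a))"
    for g :: "'n + 'n \<Rightarrow> real"
    unfolding univ by (subst sum.union_disjoint) (auto simp: sum.reindex)
  show "(Jmat ** A) $ i $ j = Jrows A $ i $ j"
    unfolding matrix_matrix_mult_def Jrows_def
    by (cases i) (simp_all add: split Jmat_def if_distrib[of "\<lambda>x. x * _"] cong: if_cong)
qed

lemma Jrows_mult_eq_0_iff:
  fixes A :: "complex ^ 'c ^ ('n::finite + 'n)"
  shows "Jrows A *v c = 0 \<longleftrightarrow> A *v c = 0"
proof -
  have "(Jrows A *v c) $ Inl a = (A *v c) $ Inr a" "(Jrows A *v c) $ Inr a = - (A *v c) $ Inl a" for a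
    by (simp_all add: Jrows_def matrix_vector_mult_def sum_negf)
  then show ?thesis
    by (auto simp: vec_eq_iff split_sum_all)
qed

text \<open>
  Transposition fixes \<open>J H\<^sub>0\<close> and exchanges \<open>J H\<^sub>k\<close> with \<open>J H\<^sub>-\<^sub>k\<close>, which has the same
  effect as exchanging the exponentials \<open>exp (s \<tau>\<^sub>k)\<close> and \<open>exp (- s \<tau>\<^sub>k)\<close>. The sign of the
  linear term changes because \<open>J\<close> is skew.
\<close>

lemma transpose_Jrows_char_matrix:
  fixes H :: "int \<Rightarrow> real ^ ('n::finite + 'n) ^ ('n + 'n)"
  assumes H0: "transpose (Jmat ** H 0) = Jmat ** H 0"
    and Hk: "\<forall>k \<in> {1..K}. transpose (Jmat ** H (- int k)) = Jmat ** H (int k)"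
  shows "transpose (Jrows (char_matrix K \<tau> H s)) = Jrows (char_matrix K \<tau> H (- s))"
proof -
  \<comment> \<open>Row \<open>i\<close> of \<open>J A\<close> is \<open>\<epsilon> i\<close> times row \<open>\<pi> i\<close> of \<open>A\<close>.\<close>
  define \<epsilon> :: "'n + 'n \<Rightarrow> real" where "\<epsilon> i = (case i of Inl _ \<Rightarrow> 1 | Inr _ \<Rightarrow> - 1)" for i
  define \<pi> :: "'n + 'n \<Rightarrow> 'n + 'n" where "\<pi> i = (case i of Inl a \<Rightarrow> Inr a | Inr a \<Rightarrow> Inl a)" for i
  have nth_r: "Jrows A $ i $ j = \<epsilon> i * A $ \<pi> i $ j" for A :: "real ^ ('n + 'n) ^ ('n + 'n)" and i j
    by (cases i) (simp_all add: Jrows_def \<epsilon>_def \<pi>_def)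
  have nth_c: "Jrows A $ i $ j = of_real (\<epsilon> i) * A $ \<pi> i $ j"
    for A :: "complex ^ ('n + 'n) ^ ('n + 'n)" and i j
    by (cases i) (simp_all add: Jrows_def \<epsilon>_def \<pi>_def)
  have h0: "complex_of_real (\<epsilon> j) * of_real (H 0 $ \<pi> j $ i) = of_real (\<epsilon> i) * of_real (H 0 $ \<pi> i $ j)"
    for i j
    using arg_cong[OF H0, of "\<lambda>A. A $ i $ j"]
    by (simp add: Jmat_mult transpose_def nth_r flip: of_real_mult)
  have hk: "complex_of_real (\<epsilon> j) * of_real (H (- int k) $ \<pi> j $ i)
      = of_real (\<epsilon> i) * of_real (H (int k) $ \<pi> i $ j)" if "k \<in> {1..K}" for i j k
    using arg_cong[OF bspec[OF Hk that], of "\<lambda>A. A $ i $ j"]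
    by (simp add: Jmat_mult transpose_def nth_r flip: of_real_mult)
  have m: "of_real (\<epsilon> j) * (mat s :: complex ^ ('n + 'n) ^ ('n + 'n)) $ \<pi> j $ i
      = of_real (\<epsilon> i) * (mat (- s) :: complex ^ ('n + 'n) ^ ('n + 'n)) $ \<pi> i $ j" for i j
    by (cases i; cases j) (auto simp: mat_def \<epsilon>_def \<pi>_def)
  have "of_real (\<epsilon> j) * char_matrix K \<tau> H s $ \<pi> j $ i
      = of_real (\<epsilon> i) * char_matrix K \<tau> H (- s) $ \<pi> i $ j" for i j
  proof -
    have "of_real (\<epsilon> j) * (\<Sum>k=1..K. of_real (H (- int k) $ \<pi> j $ i) * exp (- s * of_real (\<tau> k))
                 + of_real (H (int k) $ \<pi> j $ i) * exp (s * of_real (\<tau> k)))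
      = of_real (\<epsilon> i) * (\<Sum>k=1..K. of_real (H (- int k) $ \<pi> i $ j) * exp (- (- s) * of_real (\<tau> k))
                 + of_real (H (int k) $ \<pi> i $ j) * exp (- s * of_real (\<tau> k)))"
      unfolding sum_distrib_left
    proof (intro sum.cong refl)
      fix k assume "k \<in> {1..K}"
      from hk[OF this, of j i] hk[OF this, of i j]
      show "of_real (\<epsilon> j) * (of_real (H (- int k) $ \<pi> j $ i) * exp (- s * of_real (\<tau> k))
                 + of_real (H (int k) $ \<pi> j $ i) * exp (s * of_real (\<tau> k)))
        = of_real (\<epsilon> i) * (of_real (H (- int k) $ \<pi> i $ j) * exp (- (- s) * of_real (\<tau> k))
                 + of_real (H (int k) $ \<pi> i $ j) * exp (- s * of_real (\<tau> k)))"
        by (simp add: distrib_left flip: mult.assoc)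
    qed
    with h0[of j i] m[of j i] show ?thesis
      by (simp add: char_matrix_def right_diff_distrib)
  qed
  then show ?thesis
    by (simp add: vec_eq_iff transpose_def nth_c)
qed

lemma ex_kernel_transpose_iff:
  fixes A :: "complex ^ 'm::finite ^ 'm"
  shows "(\<exists>c. c \<noteq> 0 \<and> transpose A *v c = 0) \<longleftrightarrow> (\<exists>c. c \<noteq> 0 \<and> A *v c = 0)"
proof -
  have "invertible B \<longleftrightarrow> \<not> (\<exists>c. c \<noteq> 0 \<and> B *v c = 0)" for B :: "complex ^ 'm ^ 'm"
    unfolding invertible_left_inverse matrix_left_invertible_ker by blast
  then show ?thesis
    using invertible_det_nz[of A] invertible_det_nz[of "transpose A"]
    by (simp only: det_transpose) blast
qed

text \<open>
  Up to the invertible factor \<open>J\<close>, the characteristic matrices at \<open>s\<close> and \<open>-s\<close> are transposes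
  of each other, so they are singular together.
\<close>

lemma Hop_eigenvalue_minus_iff:
  fixes H :: "int \<Rightarrow> real ^ ('n::finite + 'n) ^ ('n + 'n)"
  assumes "delay_equation K \<tau>"
    and "transpose (Jmat ** H 0) = Jmat ** H 0"
    and "\<forall>k \<in> {1..K}. transpose (Jmat ** H (- int k)) = Jmat ** H (int k)"
  shows "Hop_eigenvalue K \<tau> H (- s) \<longleftrightarrow> Hop_eigenvalue K \<tau> H s"
proof -
  interpret delay_equation K \<tau> H
    by fact
  have "Hop_eigenvalue K \<tau> H (- s)
      \<longleftrightarrow> (\<exists>c. c \<noteq> 0 \<and> transpose (Jrows (char_matrix K \<tau> H s)) *v c = 0)"
    unfolding Hop_eigenvalue_iff transpose_Jrows_char_matrix[where K = K and H = H, OF assms(2,3)]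
      Jrows_mult_eq_0_iff ..
  also have "\<dots> \<longleftrightarrow> Hop_eigenvalue K \<tau> H s"
    unfolding Hop_eigenvalue_iff ex_kernel_transpose_iff Jrows_mult_eq_0_iff ..
  finally show ?thesis .
qed

section \<open>The intersection with a Krylov subspace\<close>

theorem theorem3p5:
  fixes K m :: nat
    and \<tau> :: "nat \<Rightarrow> real"
    and H :: "int \<Rightarrow> real ^ ('n::finite + 'n) ^ ('n + 'n)"
    and \<sigma> ev :: complex
    and \<phi>\<^sub>1 \<phi>p \<phi>m :: "real \<Rightarrow> complex ^ ('n + 'n)"
  assumes "K \<ge> 1"
    and "0 < \<tau> 1" and "strict_mono_on {1..K} \<tau>"
    and "transpose (Jmat ** H 0) = Jmat ** H 0"
    and "\<And>k. k \<in> {1..K} \<Longrightarrow> transpose (Jmat ** H (- int k)) = Jmat ** H (int k)"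
    and "m \<ge> 1"
    and "\<not> Hop_eigenvalue K \<tau> H \<sigma>"
    and "\<phi>\<^sub>1 \<in> cfun_space (\<tau> K)" and "\<And>t i. \<phi>\<^sub>1 t $ i \<in> \<real>"
    and "ev \<noteq> 0"
    and "simple_Hop_eigenvalue K \<tau> H ev \<or> simple_nlevp_eigenvalue K \<tau> H ev"
    and "Hop_eigenfunction K \<tau> H ev \<phi>p"
    and "Hop_eigenfunction K \<tau> H (- ev) \<phi>m"
  shows "cfun.dim (cfun.span {\<phi>p, \<phi>m} \<inter> krylov m (Rop_inv K \<tau> H \<sigma>) \<phi>\<^sub>1) \<le> 1"
proof -
  let ?X = "cfun_space (\<tau> K) :: (real \<Rightarrow> complex ^ ('n + 'n)) set"
  let ?A = "Rop_inv K \<tau> H \<sigma>"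
  have mono: "\<tau> i \<le> \<tau> j" if "1 \<le> i" "i \<le> j" "j \<le> K" for i j
    using strict_mono_on_leD[OF assms(3), of i j] that by simp
  have "delay_equation K \<tau>"
  proof
    show "\<tau> ` {1..K} \<subseteq> {0..\<tau> K}"
    proof (intro image_subsetI)
      fix k assume "k \<in> {1..K}"
      then show "\<tau> k \<in> {0..\<tau> K}"
        using mono[of 1 k] mono[of k K] assms(2) by auto
    qed
    show "0 < \<tau> K"
      using mono[of 1 K] assms(1,2) by simp
  qed
  then interpret delay_equation K \<tau> H .
  have "\<not> Hop_eigenvalue K \<tau> H (- \<sigma>)"
    using Hop_eigenvalue_minus_iff[where H = H, OF \<open>delay_equation K \<tau>\<close> assms(4)] assms(5,7) by blast
  note bij = Rop_bij_betw[OF assms(7) this]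
  define \<mu> where "\<mu> = 1 / (ev\<^sup>2 - \<sigma>\<^sup>2)"
  obtain w where w:
    "{x \<in> krylov m ?A \<phi>\<^sub>1. ?A x = cscale \<mu> x} \<subseteq> cfun.span {w}"
    unfolding krylov_def
    by (rule cfun.krylov_eigenspace_subset_line[OF subspace_cfun_space assms(8)
          Rop_inv_in_cfun_space[OF bij] Rop_inv_add[OF bij] Rop_inv_cscale[OF bij]])
  define E where "E = {x \<in> ?X. ?A x = cscale \<mu> x}"
  have "?A 0 = 0"
    using Rop_inv_cscale[OF bij cfun.subspace_0[OF subspace_cfun_space], of 0] by simp
  then have "cfun.subspace E"
    unfolding cfun.subspace_def E_def
    by (auto simp: Rop_inv_add[OF bij] Rop_inv_cscale[OF bij] cfun.scale_right_distrib mult.commute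
        subspace_cfun_space[THEN cfun.subspace_0] subspace_cfun_space[THEN cfun.subspace_add]
        subspace_cfun_space[THEN cfun.subspace_scale])
  moreover have "{\<phi>p, \<phi>m} \<subseteq> E"
    using assms(12,13) Rop_inv_eigenfunction[OF bij assms(12)] Rop_inv_eigenfunction[OF bij assms(13)]
    by (auto simp: E_def \<mu>_def Hop_eigenfunction_def Hop_dom_def c1fun_space_def)
  ultimately have "cfun.span {\<phi>p, \<phi>m} \<subseteq> E"
    by (intro cfun.span_minimal)
  then have "cfun.span {\<phi>p, \<phi>m} \<inter> krylov m ?A \<phi>\<^sub>1 \<subseteq> cfun.span {w}"
    using w by (auto simp: E_def)
  from cfun.dim_le_card[OF this] show ?thesis
    by simp
qed

end
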